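(* Consider the unidirectional-traffic access game, and let $\tau'\in(0,1)$ be such that the homogeneous outcome $\boldsymbol\tau'=(\tau',\dots,\tau')$ maximizes the social utility $\min_i S_u^i(\boldsymbol\tau)$ over $\boldsymbol\tau\in[0,1]^n$ in the absence of ACK suppression. If the ACK suppression scheme is implemented with $$\gamma=\tau',\qquad \alpha\ \ge\ \frac{1}{\tau'\left(1+\tau'\left(-1+\dfrac{T}{T-(T-\sigma)(1-\tau')^{n-1}}\right)\right)},$$ then $\boldsymbol\tau'$ is a Pareto optimal Nash equilibrium of the game whose utilities are those under ACK suppression.
   Context: Parameters: an integer $n\ge2$ (number of stations), real constants $P>0$ (payload) and $0<\sigma<T$ (empty and busy slot durations). Each player (station) $i\in\{1,\dots,n\}$ chooses $\tau_i\in[0,1]$; the access point transmits no downlink traffic ($\tau_{AP}=0$). For $\boldsymbol\tau\in[0,1]^n$ put $p_i=1-\prod_{j\ne i}(1-\tau_j)$, $P_{idle}=(1-\tau_i)(1-p_i)=\prod_{j=1}^n(1-\tau_j)$, and $$S_u^i(\boldsymbol\tau)=\frac{\tau_i(1-p_i)P}{P_{idle}\sigma+(1-P_{idle})T}.$$ Without suppression the utility of station $i$ is $S_u^i$. ACK suppression scheme with parameters $\gamma\in(0,1)$, $\alpha>0$: whenever station $i$ has $\tau_i>\gamma$, the access point drops each acknowledgment to it with probability $\min\{\alpha(\tau_i-\gamma),1\}$. The resulting utility of station $i$ is $$J_i(\boldsymbol\tau)=\begin{cases} S_u^i(\boldsymbol\tau) & 0\le\tau_i<\gamma,\\ S_u^i(\boldsymbol\tau)\,[1-\alpha(\tau_i-\gamma)]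 & \gamma\le\tau_i<\gamma+1/\alpha,\\ 0 & \gamma+1/\alpha\le\tau_i\le1.\end{cases}$$ A Nash equilibrium is a vector $\boldsymbol\tau\in[0,1]^n$ such that no player $i$ can strictly increase $J_i$ by changing $\tau_i\in[0,1]$ alone. A vector $\boldsymbol\tau\in[0,1]^n$ is Pareto optimal if there is no $\boldsymbol\rho\in[0,1]^n$ with $J_i(\boldsymbol\rho)\ge J_i(\boldsymbol\tau)$ for all $i$ and $J_j(\boldsymbol\rho)>J_j(\boldsymbol\tau)$ for some $j$. *)

theory Defs
  imports Complex_Main "HOL-Library.Cardinality"
begin

text \<open>
  The stations are the elements of an arbitrary finite type \<open>'n\<close>, so the number of stations is
  \<open>CARD('n)\<close>. The access point does not transmit, hence it does not occur in any of the products.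
\<close>

definition profiles :: "('n::finite \<Rightarrow> real) set" where
  "profiles = {\<tau>. \<forall>i. \<tau> i \<in> {0..1}}"

definition other_tx :: "('n::finite \<Rightarrow> real) \<Rightarrow> 'n \<Rightarrow> real" where
  "other_tx \<tau> i = 1 - (\<Prod>j\<in>UNIV - {i}. 1 - \<tau> j)"

definition idle_prob :: "('n::finite \<Rightarrow> real) \<Rightarrow> real" where
  "idle_prob \<tau> = (\<Prod>j\<in>UNIV. 1 - \<tau> j)"

text \<open>
  The utility \<open>S\<^sub>u\<^sup>i\<close>; \<open>P\<close> is the payload, \<open>\<sigma>\<close> and \<open>T\<close> are the durations of an empty and of a
  busy slot.
\<close>

definition uplink :: "real \<Rightarrow> real \<Rightarrow> real \<Rightarrow> ('n::finite \<Rightarrow> real) \<Rightarrow> 'n \<Rightarrow> real" where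
  "uplink P \<sigma> T \<tau> i =
     \<tau> i * (1 - other_tx \<tau> i) * P / (idle_prob \<tau> * \<sigma> + (1 - idle_prob \<tau>) * T)"

definition social_utility :: "real \<Rightarrow> real \<Rightarrow> real \<Rightarrow> ('n::finite \<Rightarrow> real) \<Rightarrow> real" where
  "social_utility P \<sigma> T \<tau> = Min (range (\<lambda>i. uplink P \<sigma> T \<tau> i))"

text \<open>
  An acknowledgment to a station with \<open>\<tau> i > \<gamma>\<close> is dropped with probability
  \<open>min (\<alpha> * (\<tau> i - \<gamma>)) 1\<close>, so the payoff vanishes from \<open>\<gamma> + 1 / \<alpha>\<close> onwards.
\<close>

definition suppressed ::
    "real \<Rightarrow> real \<Rightarrow> real \<Rightarrow> real \<Rightarrow> real \<Rightarrow> ('n::finite \<Rightarrow> real) \<Rightarrow> 'n \<Rightarrow> real" where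
  "suppressed P \<sigma> T \<gamma> \<alpha> \<tau> i =
     (if \<tau> i < \<gamma> then uplink P \<sigma> T \<tau> i
      else if \<tau> i < \<gamma> + 1 / \<alpha> then uplink P \<sigma> T \<tau> i * (1 - \<alpha> * (\<tau> i - \<gamma>))
      else 0)"

definition nash_equilibrium ::
    "(('n::finite \<Rightarrow> real) \<Rightarrow> 'n \<Rightarrow> real) \<Rightarrow> ('n \<Rightarrow> real) \<Rightarrow> bool" where
  "nash_equilibrium u \<tau> \<longleftrightarrow>
     \<tau> \<in> profiles \<and> \<not> (\<exists>i. \<exists>x\<in>{0..1}. u (\<tau>(i := x)) i > u \<tau> i)"

definition pareto_optimal ::
    "(('n::finite \<Rightarrow> real) \<Rightarrow> 'n \<Rightarrow> real) \<Rightarrow> ('n \<Rightarrow> real) \<Rightarrow> bool" where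
  "pareto_optimal u \<tau> \<longleftrightarrow>
     \<tau> \<in> profiles \<and>
     \<not> (\<exists>\<rho>\<in>profiles. (\<forall>i. u \<rho> i \<ge> u \<tau> i) \<and> (\<exists>j. u \<rho> j > u \<tau> j))"

end

theory Submission
  imports Defs
begin

text \<open>
  Damping only lowers the utilities and leaves \<open>\<tau>'\<close> itself untouched, so a profile that
  Pareto-dominates \<open>\<tau>'\<close> under suppression also dominates it without suppression. If station
  \<open>j\<close> is strictly better off there, it can lower its transmission probability slightly and keep an
  advantage, while every other station strictly gains; then the minimum exceeds the social optimum.

  Against opponents playing \<open>t\<close>, the undamped utility of \<open>x\<close> is proportional to \<open>x / (a + b * x)\<close>
  with \<open>b = (T - \<sigma>) * (1 - t) ^ (n - 1)\<close> and \<open>a = T - b\<close>, which increases in \<open>x\<close>. The damping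
  offsets the gain beyond \<open>t\<close> as soon as it does so to first order, that is, when
  \<open>\<alpha> * t * (a + b * t) \<ge> a\<close>, which is the lower bound on \<open>\<alpha>\<close>.
\<close>

section \<open>The undamped utility as a function of one station's own choice\<close>

lemma uplink_altdef:
  "uplink P \<sigma> T \<tau> i =
     \<tau> i * (\<Prod>k\<in>UNIV - {i}. 1 - \<tau> k) * P /
     (T - (T - \<sigma>) * ((1 - \<tau> i) * (\<Prod>k\<in>UNIV - {i}. 1 - \<tau> k)))"
proof -
  have "idle_prob \<tau> = (1 - \<tau> i) * (\<Prod>k\<in>UNIV - {i}. 1 - \<tau> k)"
    unfolding idle_prob_def by (simp add: prod.remove[of UNIV i])
  moreover have "q * \<sigma> + (1 - q) * T = T - (T - \<sigma>) * q" for q :: real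
    by (simp add: algebra_simps)
  ultimately show ?thesis
    by (simp add: uplink_def other_tx_def)
qed

text \<open>For an idle probability \<open>q\<close> this is the mean slot duration; it is at least
  \<sigma>.\<close>

lemma slot_duration_pos:
  fixes \<sigma> T q :: real
  assumes "0 < \<sigma>" "\<sigma> < T" "q \<le> 1"
  shows "T - (T - \<sigma>) * q > 0"
proof -
  have "(T - \<sigma>) * q \<le> (T - \<sigma>) * 1"
    using assms by (intro mult_left_mono) auto
  then show ?thesis using assms unfolding mult_1_right by linarith
qed

lemma others_silent_bounds:
  assumes "\<tau> \<in> profiles"
  shows "0 \<le> (\<Prod>k\<in>A. 1 - \<tau> k)" "(\<Prod>k\<in>A. 1 - \<tau> k) \<le> 1"
  using assms by (auto simp: profiles_def intro!: prod_nonneg prod_le_1)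

lemma uplink_upd_own:
  "uplink P \<sigma> T (\<tau>(i := x)) i =
     x * (\<Prod>k\<in>UNIV - {i}. 1 - \<tau> k) * P /
     (T - (T - \<sigma>) * ((1 - x) * (\<Prod>k\<in>UNIV - {i}. 1 - \<tau> k)))"
proof -
  have "(\<Prod>k\<in>UNIV - {i}. 1 - (\<tau>(i := x)) k) = (\<Prod>k\<in>UNIV - {i}. 1 - \<tau> k)"
    by (intro prod.cong) auto
  then show ?thesis by (simp add: uplink_altdef)
qed

lemma uplink_nonneg:
  assumes "0 < \<sigma>" "\<sigma> < T" "P \<ge> 0" "\<tau> \<in> profiles"
  shows "uplink P \<sigma> T \<tau> i \<ge> 0"
proof -
  let ?Q = "\<Prod>k\<in>UNIV - {i}. 1 - \<tau> k"
  have \<tau>: "0 \<le> \<tau> i" "\<tau> i \<le> 1" using assms by (auto simp: profiles_def)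
  have Q: "0 \<le> ?Q" "?Q \<le> 1" using others_silent_bounds assms by blast+
  have "(1 - \<tau> i) * ?Q \<le> 1" using \<tau> Q by (intro mult_le_one) auto
  then have "T - (T - \<sigma>) * ((1 - \<tau> i) * ?Q) > 0"
    using slot_duration_pos assms by blast
  then show ?thesis using assms \<tau> Q by (simp add: uplink_altdef)
qed

text \<open>A quieter rival raises the success probability of \<open>i\<close> and, by making idle
  slots more likely, cannot lengthen the mean slot. Strictness comes from the numerator, whose other
  factors are positive because all probabilities lie strictly between 0 and 1.\<close>

lemma uplink_upd_other_less:
  assumes "0 < \<sigma>" "\<sigma> < T" "P > 0"
    and \<tau>: "\<And>k. 0 < \<tau> k" "\<And>k. \<tau> k < 1"
    and "i \<noteq> j" "0 \<le> y" "y < \<tau> j"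
  shows "uplink P \<sigma> T \<tau> i < uplink P \<sigma> T (\<tau>(j := y)) i"
proof -
  define A where "A = (\<Prod>k\<in>UNIV - {i} - {j}. 1 - \<tau> k)"
  have split: "(\<Prod>k\<in>UNIV - {i}. 1 - f k) = (1 - f j) * (\<Prod>k\<in>UNIV - {i} - {j}. 1 - f k)"
    for f :: "'a \<Rightarrow> real"
    using \<open>i \<noteq> j\<close> by (intro prod.remove) auto
  have Q: "(\<Prod>k\<in>UNIV - {i}. 1 - \<tau> k) = (1 - \<tau> j) * A"
    by (simp add: split A_def)
  have "(\<Prod>k\<in>UNIV - {i} - {j}. 1 - (\<tau>(j := y)) k) = A"
    unfolding A_def by (intro prod.cong) auto
  then have Q': "(\<Prod>k\<in>UNIV - {i}. 1 - (\<tau>(j := y)) k) = (1 - y) * A"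
    by (simp add: split)
  have A: "A > 0" "A \<le> 1"
    using \<tau> by (auto simp: A_def less_imp_le intro!: prod_pos prod_le_1)
  have less: "(1 - \<tau> j) * A < (1 - y) * A"
    using A assms by simp
  have pos: "(1 - \<tau> j) * A > 0" using A \<tau> by simp
  have "(1 - y) * A \<le> 1"
    using A \<open>0 \<le> y\<close> \<open>y < \<tau> j\<close> \<tau>(2)[of j] by (intro mult_le_one) auto
  then have le1: "(1 - \<tau> i) * ((1 - y) * A) \<le> 1"
    using \<tau>[of i] less pos by (intro mult_le_one[of "1 - \<tau> i"]) linarith+
  have "T - (T - \<sigma>) * ((1 - \<tau> i) * ((1 - y) * A)) > 0"
    using slot_duration_pos assms(1,2) le1 by blast
  moreover have "T - (T - \<sigma>) * ((1 - \<tau> i) * ((1 - y) * A))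
      \<le> T - (T - \<sigma>) * ((1 - \<tau> i) * ((1 - \<tau> j) * A))"
    using less \<tau>[of i] assms by simp
  moreover have "\<tau> i * ((1 - \<tau> j) * A) * P < \<tau> i * ((1 - y) * A) * P"
    using less \<tau>[of i] assms A by (intro mult_strict_right_mono mult_strict_left_mono) auto
  moreover have "0 \<le> \<tau> i * ((1 - \<tau> j) * A) * P"
    using A(1) \<tau>(1)[of i] \<tau>(2)[of j] assms(3) by (simp add: less_imp_le)
  ultimately have "\<tau> i * ((1 - \<tau> j) * A) * P / (T - (T - \<sigma>) * ((1 - \<tau> i) * ((1 - \<tau> j) * A)))
      < \<tau> i * ((1 - y) * A) * P / (T - (T - \<sigma>) * ((1 - \<tau> i) * ((1 - y) * A)))"
    by (intro frac_less) auto
  then show ?thesis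
    using \<open>i \<noteq> j\<close> by (simp add: uplink_altdef Q Q' del: fun_upd_apply) simp
qed

section \<open>Social optimality without damping\<close>

lemma less_social_utility_iff:
  "v < social_utility P \<sigma> T \<tau> \<longleftrightarrow> (\<forall>i. v < uplink P \<sigma> T \<tau> i)"
  by (simp add: social_utility_def)

text \<open>Continuity in the own coordinate, the denominator being nonzero. The limit is from the
  left because the station is going to reduce its probability.\<close>

lemma uplink_upd_own_eventually_greater:
  assumes "0 < \<sigma>" "\<sigma> < T" "\<tau> \<in> profiles" "v < uplink P \<sigma> T \<tau> j"
  shows "\<forall>\<^sub>F y in at_left (\<tau> j). v < uplink P \<sigma> T (\<tau>(j := y)) j"
proof -
  let ?Q = "\<Prod>k\<in>UNIV - {j}. 1 - \<tau> k"
  have "(1 - \<tau> j) * ?Q \<le> 1"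
    using others_silent_bounds[OF assms(3)] assms(3)
    by (intro mult_le_one) (auto simp: profiles_def)
  then have "T - (T - \<sigma>) * ((1 - \<tau> j) * ?Q) \<noteq> 0"
    using slot_duration_pos[OF assms(1,2)] by (metis less_irrefl)
  then have "((\<lambda>y. uplink P \<sigma> T (\<tau>(j := y)) j) \<longlongrightarrow> uplink P \<sigma> T \<tau> j) (at_left (\<tau> j))"
    unfolding uplink_upd_own unfolding uplink_altdef by (intro tendsto_intros)
  then show ?thesis
    using assms(4) order_tendstoD(1) by blast
qed

lemma social_optimum_undominated:
  fixes \<tau> \<rho> :: "'n::finite \<Rightarrow> real"
  assumes card: "CARD('n) \<ge> 2"
    and par: "P > 0" "0 < \<sigma>" "\<sigma> < T"
    and opt: "is_arg_max (social_utility P \<sigma> T) (\<lambda>\<tau>. \<tau> \<in> profiles) \<tau>"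
    and eq: "\<And>i. uplink P \<sigma> T \<tau> i = v" and "v > 0"
    and \<rho>: "\<rho> \<in> profiles" and ge: "\<And>i. v \<le> uplink P \<sigma> T \<rho> i"
  shows "uplink P \<sigma> T \<rho> j \<le> v"
proof (rule ccontr)
  assume "\<not> ?thesis"
  then have gt: "v < uplink P \<sigma> T \<rho> j" by simp
  \<comment> \<open>Since \<open>v\<close> is positive, no utility vanishes under \<rho>. This
    forces \<rho> into the open cube, as strict monotonicity requires.\<close>
  have up: "uplink P \<sigma> T \<rho> i \<noteq> 0" for i using ge[of i] \<open>v > 0\<close> by linarith
  have "\<rho> i \<noteq> 0" for i
    using up[of i] by (auto simp: uplink_altdef)
  then have \<rho>0: "0 < \<rho> i" for i
    using \<rho> by (simp add: profiles_def order.not_eq_order_implies_strict)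
  have \<rho>1: "\<rho> k < 1" for k
  proof -
    \<comment> \<open>With at least two stations there is some \<open>i\<close> other than
      \<open>k\<close>; if \<open>k\<close> always transmitted, \<open>i\<close> would get
      nothing.\<close>
    have "card {k} \<noteq> CARD('n)" using card by simp
    then have "{k} \<noteq> UNIV" by metis
    then obtain i where "i \<noteq> k" by blast
    then have "\<rho> k \<noteq> 1"
      using up[of i] by (auto simp: uplink_altdef)
    then show ?thesis
      using \<rho> by (simp add: profiles_def order.not_eq_order_implies_strict)
  qed
  have "\<forall>\<^sub>F y in at_left (\<rho> j). y \<in> {0<..<\<rho> j}"
    using \<rho>0 by (rule eventually_at_leftI[rotated])
  moreover have "\<forall>\<^sub>F y in at_left (\<rho> j). v < uplink P \<sigma> T (\<rho>(j := y)) j"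
    using uplink_upd_own_eventually_greater par \<rho> gt by blast
  ultimately have "\<forall>\<^sub>F y in at_left (\<rho> j). y \<in> {0<..<\<rho> j} \<and> v < uplink P \<sigma> T (\<rho>(j := y)) j"
    by (rule eventually_conj)
  from eventually_happens'[OF trivial_limit_at_left_real this]
  obtain y where y: "0 < y" "y < \<rho> j" "v < uplink P \<sigma> T (\<rho>(j := y)) j"
    by auto
  have "v < uplink P \<sigma> T (\<rho>(j := y)) i" for i
  proof (cases "i = j")
    case False
    then have "uplink P \<sigma> T \<rho> i < uplink P \<sigma> T (\<rho>(j := y)) i"
      using par \<rho>0 \<rho>1 y by (intro uplink_upd_other_less) auto
    then show ?thesis using ge[of i] by linarith
  qed (use y in simp)
  then have "v < social_utility P \<sigma> T (\<rho>(j := y))"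
    by (simp add: less_social_utility_iff)
  moreover have "social_utility P \<sigma> T \<tau> = v"
    by (simp add: social_utility_def eq)
  moreover have "\<rho>(j := y) \<in> profiles"
    using \<rho> y \<rho>1[of j] by (auto simp: profiles_def)
  ultimately show False
    using opt by (auto simp: is_arg_max_def)
qed

section \<open>The effect of damping\<close>

lemma suppressed_le_uplink:
  assumes "0 < \<sigma>" "\<sigma> < T" "P \<ge> 0" "\<tau> \<in> profiles" "\<alpha> \<ge> 0"
  shows "suppressed P \<sigma> T \<gamma> \<alpha> \<tau> i \<le> uplink P \<sigma> T \<tau> i"
  using uplink_nonneg[OF assms(1-4)] assms(5)
  by (auto simp: suppressed_def intro!: mult_left_le)

text \<open>With \<open>y = x - t\<close> and denominators cleared, left minus right is \<open>y *
  (a - \<alpha> * t * (a + b * t)) - \<alpha> * y * y * (a + b * t)\<close>, and both terms are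
  nonpositive. A negative damping factor does no harm, so \<open>x\<close> has no upper
  limit.\<close>

lemma damped_ratio_le:
  fixes a b t x \<alpha> :: real
  assumes "a > 0" "b \<ge> 0" "t > 0" "t \<le> x" "\<alpha> \<ge> 0"
    and \<alpha>: "a \<le> \<alpha> * t * (a + b * t)"
  shows "x / (a + b * x) * (1 - \<alpha> * (x - t)) \<le> t / (a + b * t)"
proof -
  define y where "y = x - t"
  have y: "y \<ge> 0" "x = t + y" using assms by (auto simp: y_def)
  have "a * y \<le> \<alpha> * t * (a + b * t) * y"
    using \<alpha> y by (intro mult_right_mono) auto
  moreover have "0 \<le> \<alpha> * y * y * (a + b * t)"
    using assms y by simp
  ultimately have "x * (1 - \<alpha> * (x - t)) * (a + b * t) \<le> t * (a + b * x)"
    by (simp add: y algebra_simps)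
  moreover have "a + b * x > 0" "a + b * t > 0"
    using assms by (auto intro!: add_pos_nonneg)
  ultimately show ?thesis
    by (simp add: divide_simps mult_ac)
qed

theorem proposition3p1:
  fixes P \<sigma> T t \<gamma> \<alpha> :: real
    and \<tau>' :: "'n::finite \<Rightarrow> real"
  assumes "CARD('n) \<ge> 2"
    and "P > 0" and "0 < \<sigma>" and "\<sigma> < T"
    and "0 < t" and "t < 1"
    and "\<tau>' = (\<lambda>_. t)"
    and "is_arg_max (social_utility P \<sigma> T) (\<lambda>\<tau>. \<tau> \<in> profiles) \<tau>'"
    and "\<gamma> = t"
    and "\<alpha> > 0"
    and "\<alpha> \<ge> 1 / (t * (1 + t * (- 1 + T / (T - (T - \<sigma>) * (1 - t) ^ (CARD('n) - 1)))))"
  shows "nash_equilibrium (suppressed P \<sigma> T \<gamma> \<alpha>) \<tau>' \<and>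
         pareto_optimal (suppressed P \<sigma> T \<gamma> \<alpha>) \<tau>'"
proof
  \<comment> \<open>\<open>Q\<close> is the probability that all opponents stay silent, and
    \<open>a + b * x\<close> the mean slot duration when one station plays \<open>x\<close> against
    them.\<close>
  define Q where "Q = (1 - t) ^ (CARD('n) - 1)"
  define b where "b = (T - \<sigma>) * Q"
  define a where "a = T - b"
  note par = assms(2-6)
  have Q: "0 < Q" "Q \<le> 1"
    using par by (auto simp: Q_def power_le_one)
  have "a > 0"
    using slot_duration_pos[OF par(2,3) Q(2)] by (simp add: a_def b_def)
  have "b > 0" using par Q by (simp add: b_def)
  have in_profiles: "\<tau>' \<in> profiles"
    using par by (simp add: assms(7) profiles_def)
  have dev: "uplink P \<sigma> T (\<tau>'(i := x)) i = Q * P * (x / (a + b * x))" for i x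
  proof -
    have "(\<Prod>k\<in>UNIV - {i}. 1 - \<tau>' k) = Q"
      by (simp add: assms(7) Q_def)
    moreover have "T - (T - \<sigma>) * ((1 - x) * Q) = a + b * x"
      by (simp add: a_def b_def algebra_simps)
    ultimately show ?thesis by (simp add: uplink_upd_own)
  qed
  have v: "uplink P \<sigma> T \<tau>' i = Q * P * (t / (a + b * t))" for i
    using dev[of i t] by (simp add: assms(7) fun_upd_idem)
  have v_pos: "Q * P * (t / (a + b * t)) > 0"
    using Q par \<open>a > 0\<close> \<open>b > 0\<close> by (simp add: add_pos_pos)
  \<comment> \<open>Exactly at the threshold the second branch applies, with damping factor
    1.\<close>
  have supp: "suppressed P \<sigma> T \<gamma> \<alpha> \<tau>' i = Q * P * (t / (a + b * t))" for i
    using assms(7,9,10) v[of i] by (simp add: suppressed_def)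
  have "1 / (t * (1 + t * (- 1 + T / a))) = a / (t * (a + b * t))"
  proof -
    \<comment> \<open>Uses \<open>T = a + b\<close>.\<close>
    have "1 + t * (- 1 + T / a) = (a + b * t) / a"
      using \<open>a > 0\<close> by (simp add: field_simps a_def)
    then show ?thesis by simp
  qed
  then have "a / (t * (a + b * t)) \<le> \<alpha>"
    using assms(11) by (simp add: a_def b_def Q_def)
  then have bound: "a \<le> \<alpha> * t * (a + b * t)"
    using par \<open>a > 0\<close> \<open>b > 0\<close> by (simp add: pos_divide_le_eq add_pos_pos mult.assoc)
  show "nash_equilibrium (suppressed P \<sigma> T \<gamma> \<alpha>) \<tau>'"
    unfolding nash_equilibrium_def supp
  proof (intro conjI notI in_profiles; clarify)
    fix i and x :: real
    assume x: "x \<in> {0..1}"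
      and less: "Q * P * (t / (a + b * t)) < suppressed P \<sigma> T \<gamma> \<alpha> (\<tau>'(i := x)) i"
    have "suppressed P \<sigma> T \<gamma> \<alpha> (\<tau>'(i := x)) i \<le> Q * P * (t / (a + b * t))"
    proof (cases "x < t")
      case True
      then have "x * a \<le> t * a"
        using \<open>a > 0\<close> by simp
      then have "x * (a + b * t) \<le> t * (a + b * x)"
        by (simp add: algebra_simps)
      moreover have "a + b * x > 0" "a + b * t > 0"
        using x par \<open>a > 0\<close> \<open>b > 0\<close> by (simp_all add: add_pos_nonneg)
      ultimately have "x / (a + b * x) \<le> t / (a + b * t)"
        by (simp add: pos_divide_le_eq pos_le_divide_eq)
      then have "Q * P * (x / (a + b * x)) \<le> Q * P * (t / (a + b * t))"
        using Q par by (intro mult_left_mono) auto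
      then show ?thesis
        using True by (simp add: suppressed_def assms(9) dev)
    next
      case False
      then have "x / (a + b * x) * (1 - \<alpha> * (x - t)) \<le> t / (a + b * t)"
        using par \<open>a > 0\<close> \<open>b > 0\<close> assms(10) bound by (intro damped_ratio_le) auto
      then have "Q * P * (x / (a + b * x) * (1 - \<alpha> * (x - t))) \<le> Q * P * (t / (a + b * t))"
        using Q par by (intro mult_left_mono) auto
      \<comment> \<open>Once every acknowledgment is dropped the payoff is 0, and
        \<open>v_pos\<close> settles the comparison.\<close>
      then show ?thesis
        using False v_pos by (simp add: suppressed_def assms(9) dev mult.assoc)
    qed
    with less show False by simp
  qed
  show "pareto_optimal (suppressed P \<sigma> T \<gamma> \<alpha>) \<tau>'"
    unfolding pareto_optimal_def supp
  proof (intro conjI notI in_profiles; clarify)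
    fix \<rho> :: "'n \<Rightarrow> real" and j
    assume \<rho>: "\<rho> \<in> profiles"
      and ge: "\<forall>i. Q * P * (t / (a + b * t)) \<le> suppressed P \<sigma> T \<gamma> \<alpha> \<rho> i"
      and gt: "Q * P * (t / (a + b * t)) < suppressed P \<sigma> T \<gamma> \<alpha> \<rho> j"
    \<comment> \<open>The reference value is the same with and without damping, so the comparison
      with \<rho> transfers to the undamped game.\<close>
    have le: "suppressed P \<sigma> T \<gamma> \<alpha> \<rho> i \<le> uplink P \<sigma> T \<rho> i" for i
      using suppressed_le_uplink \<rho> par(1-3) assms(10) by (metis less_imp_le)
    have "Q * P * (t / (a + b * t)) \<le> uplink P \<sigma> T \<rho> i" for i
      using ge le[of i] order_trans by blast
    then have "uplink P \<sigma> T \<rho> j \<le> Q * P * (t / (a + b * t))"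
      using social_optimum_undominated[OF assms(1) par(1-3) assms(8) v v_pos \<rho>] by blast
    with gt le[of j] show False by linarith
  qed
qed

end
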